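(* For every $n\ge 1$ and every permutation $\pi$ of $[n]$, we have $pbid(\pi)\ge g(\pi)/2$.
   Context: Permutations of $[n]=\{1,\dots,n\}$ are written as sequences $\pi=\langle\pi_1\,\pi_2\cdots\pi_n\rangle$ with $\pi_i=\pi(i)$; products are compositions applied right to left, so $(\pi\sigma)_i=\pi_{\sigma(i)}$; $\iota=\langle 1\,2\cdots n\rangle$ is the identity. For $1\le i<j\le k<\ell\le n+1$, the block-interchange $\beta(i,j,k,\ell)$ is the permutation $\langle 1\cdots i-1\;\; k\cdots \ell-1\;\; j\cdots k-1\;\; i\cdots j-1\;\; \ell\cdots n\rangle$, so that $\pi\beta(i,j,k,\ell)$ is obtained from $\pi$ by exchanging the blocks $\pi_i\cdots\pi_{j-1}$ and $\pi_k\cdots\pi_{\ell-1}$. A prefix block-interchange is a block-interchange with $i=1$. $pbid(\pi)$ denotes the minimum $t\ge 0$ such that there are prefix block-interchanges $\beta_1,\dots,\beta_t$ with $\pi\beta_1\cdots\beta_t=\iota$. Breakpoint graph: let $\pi'=(\pi'_0,\dots,\pi'_{2n+1})$ with $\pi'_0=0$, $\pi'_{2n+1}=2n+1$ and $(\pi'_{2i-1},\pi'_{2i})=(2\pi_i-1,2\pi_i)$ for $1\le i\le n$. $G(\pi)$ is the graph on vertex set $\{0,\dots,2n+1\}$ (vertex $\pi'_p$ being at position $p$) with black edges $\{\pi'_{2i},\pi'_{2i+1}\}$ for $0\le i\le n$ and grey edges $\{2i,2i+1\}$ for $0\le i\le n$. It decomposes uniquely into edge-disjoint cycles alternating black and grey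 edges; the length of a cycle is its number of black edges, a $k$-cycle is a cycle of length $k$. $c(G(\pi))$ is the number of cycles and $c_k(G(\pi))$ the number of $k$-cycles. Let $f(\pi)=0$ if $\pi_1=1$ and $f(\pi)=1$ otherwise, and $g(\pi)=\frac{n+1+c(G(\pi))}{2}-c_1(G(\pi))-f(\pi)$. *)

theory Defs
  imports Complex_Main "HOL-Combinatorics.Permutations"
begin

text \<open>
  A permutation of [n] is a function on the natural numbers satisfying
  \<open>\<pi> permutes {1..n}\<close> (so it is the identity outside [n]); the entry \<open>\<pi>\<^sub>i\<close> is \<open>\<pi> i\<close>
  and the product \<open>\<pi> \<sigma>\<close> is \<open>\<pi> \<circ> \<sigma>\<close>.
\<close>

definition perm_of_list :: "nat list \<Rightarrow> nat \<Rightarrow> nat" where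
  "perm_of_list xs p = (if 1 \<le> p \<and> p \<le> length xs then xs ! (p - 1) else p)"

definition block_interchange :: "nat \<Rightarrow> nat \<Rightarrow> nat \<Rightarrow> nat \<Rightarrow> nat \<Rightarrow> nat \<Rightarrow> nat" where
  "block_interchange n i j k l =
     perm_of_list ([1..<i] @ [k..<l] @ [j..<k] @ [i..<j] @ [l..<n+1])"

definition prefix_block_interchanges :: "nat \<Rightarrow> (nat \<Rightarrow> nat) set" where
  "prefix_block_interchanges n =
     {block_interchange n 1 j k l | j k l. 1 < j \<and> j \<le> k \<and> k < l \<and> l \<le> n + 1}"

definition sorts_by_pbi :: "nat \<Rightarrow> (nat \<Rightarrow> nat) \<Rightarrow> (nat \<Rightarrow> nat) list \<Rightarrow> bool" where
  "sorts_by_pbi n \<pi> \<beta>s \<longleftrightarrow>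
     set \<beta>s \<subseteq> prefix_block_interchanges n \<and> \<pi> \<circ> foldr (\<circ>) \<beta>s id = id"

text \<open>The minimum is over a nonempty set, see \<open>ex_sorts_by_pbi\<close> below.\<close>

definition pbid :: "nat \<Rightarrow> (nat \<Rightarrow> nat) \<Rightarrow> nat" where
  "pbid n \<pi> = (LEAST t. \<exists>\<beta>s. length \<beta>s = t \<and> sorts_by_pbi n \<pi> \<beta>s)"

text \<open>The sequence \<open>\<pi>'\<close>: the vertex at position \<open>p\<close>, for \<open>0 \<le> p \<le> 2n+1\<close>.\<close>

definition bp_vertex :: "nat \<Rightarrow> (nat \<Rightarrow> nat) \<Rightarrow> nat \<Rightarrow> nat" where
  "bp_vertex n \<pi> p =
     (if p = 0 then 0
      else if p = 2 * n + 1 then 2 * n + 1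
      else if odd p then 2 * \<pi> ((p + 1) div 2) - 1
      else 2 * \<pi> (p div 2))"

text \<open>
  Edges carry their colour, since a black and a grey edge may join the same two
  vertices (which gives a 1-cycle).
\<close>

datatype colour = Black | Grey

type_synonym cedge = "colour \<times> nat set"

definition breakpoint_graph :: "nat \<Rightarrow> (nat \<Rightarrow> nat) \<Rightarrow> cedge set" where
  "breakpoint_graph n \<pi> =
     {(Black, {bp_vertex n \<pi> (2 * i), bp_vertex n \<pi> (2 * i + 1)}) | i. i \<le> n} \<union>
     {(Grey, {2 * i, 2 * i + 1}) | i. i \<le> n}"

text \<open>
  The edges of the closed walk \<open>vs!0, vs!1, ..., vs!(m-1), vs!0\<close>, coloured
  alternately, starting with black.
\<close>

definition closed_walk_edges :: "nat list \<Rightarrow> cedge set" where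
  "closed_walk_edges vs =
     {(if even m then Black else Grey, {vs ! m, vs ! (Suc m mod length vs)}) | m. m < length vs}"

text \<open>
  A cycle is identified with its set of coloured edges, so that it does not depend on
  the starting point or direction of traversal. Every vertex of a breakpoint graph is
  incident to exactly one edge of each colour, so its alternating cycles are exactly the
  cycles of its unique decomposition.
\<close>

definition alternating_cycles :: "cedge set \<Rightarrow> cedge set set" where
  "alternating_cycles E =
     {closed_walk_edges vs | vs.
        vs \<noteq> [] \<and> even (length vs) \<and> distinct vs \<and> closed_walk_edges vs \<subseteq> E}"

definition cycle_length :: "cedge set \<Rightarrow> nat" where
  "cycle_length C = card {e \<in> C. fst e = Black}"

definition num_cycles :: "cedge set \<Rightarrow> nat" where
  "num_cycles E = card (alternating_cycles E)"

definition num_k_cycles :: "nat \<Rightarrow> cedge set \<Rightarrow> nat" where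
  "num_k_cycles k E = card {C \<in> alternating_cycles E. cycle_length C = k}"

definition f_pbi :: "(nat \<Rightarrow> nat) \<Rightarrow> nat" where
  "f_pbi \<pi> = (if \<pi> 1 = 1 then 0 else 1)"

definition g_pbi :: "nat \<Rightarrow> (nat \<Rightarrow> nat) \<Rightarrow> real" where
  "g_pbi n \<pi> =
     (real n + 1 + real (num_cycles (breakpoint_graph n \<pi>))) / 2
     - real (num_k_cycles 1 (breakpoint_graph n \<pi>)) - real (f_pbi \<pi>)"

lemma transpose_1_prefix_block_interchange:
  assumes "1 < b" "b \<le> n"
  shows "transpose 1 b \<in> prefix_block_interchanges n"
proof -
  have "transpose 1 b p = block_interchange n 1 2 b (b + 1) p" for p
  proof -
    consider "p = 0" | "p = 1" | "1 < p" "p < b" | "p = b" | "b < p" "p \<le> n" | "p > n"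
      by linarith
    then show ?thesis
      using assms
      by cases (auto simp: block_interchange_def perm_of_list_def transpose_def nth_append
          nth_Cons' upt_rec[of 1 2] simp del: upt_Suc)
  qed
  then have "transpose 1 b = block_interchange n 1 2 b (b + 1)" by blast
  then show ?thesis
    using assms unfolding prefix_block_interchanges_def by fastforce
qed

lemma foldr_comp_append: "foldr (\<circ>) (xs @ ys) id = foldr (\<circ>) xs id \<circ> foldr (\<circ>) ys id"
  by (induction xs) (auto simp: o_assoc)

lemma ex_sorts_by_pbi:
  assumes "\<pi> permutes {1..n}"
  shows "\<exists>\<beta>s. sorts_by_pbi n \<pi> \<beta>s"
proof -
  define gen where
    "gen p \<longleftrightarrow> (\<exists>\<beta>s. set \<beta>s \<subseteq> prefix_block_interchanges n \<and> p = foldr (\<circ>) \<beta>s id)"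
    for p :: "nat \<Rightarrow> nat"
  have gen_id: "gen id"
    unfolding gen_def by (rule exI[of _ "[]"]) simp
  have gen_comp: "gen (p \<circ> q)" if "gen p" "gen q" for p q
  proof -
    from that obtain xs ys where "set xs \<subseteq> prefix_block_interchanges n" "p = foldr (\<circ>) xs id"
      "set ys \<subseteq> prefix_block_interchanges n" "q = foldr (\<circ>) ys id"
      unfolding gen_def by blast
    then show ?thesis
      unfolding gen_def by (intro exI[of _ "xs @ ys"]) (simp add: foldr_comp_append del: foldr_append)
  qed
  have gen_1: "gen (transpose 1 b)" if "b \<in> {1..n}" for b
  proof (cases "b = 1")
    case True
    then show ?thesis using gen_id by simp
  next
    case False
    then have "transpose 1 b \<in> prefix_block_interchanges n"
      using that by (intro transpose_1_prefix_block_interchange) auto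
    then show ?thesis
      unfolding gen_def by (intro exI[of _ "[transpose 1 b]"]) simp
  qed
  have gen_transpose: "gen (transpose a b)" if "a \<in> {1..n}" "b \<in> {1..n}" for a b
  proof -
    consider "a = b" | "a = 1" | "b = 1" | "a \<noteq> b" "a \<noteq> 1" "b \<noteq> 1" by blast
    then show ?thesis
    proof cases
      case 4
      then have "transpose a b = transpose 1 a \<circ> (transpose 1 b \<circ> transpose 1 a)"
        by (auto simp: fun_eq_iff transpose_def)
      then show ?thesis using gen_1 gen_comp that by metis
    qed (use gen_id gen_1 that in \<open>auto simp: transpose_commute\<close>)
  qed
  have "gen (inv \<pi>)"
    by (rule permutes_induct[OF permutes_inv[OF assms]])
       (blast intro: finite_atLeastAtMost gen_id gen_comp gen_transpose)+
  then obtain \<beta>s where "set \<beta>s \<subseteq> prefix_block_interchanges n" "inv \<pi> = foldr (\<circ>) \<beta>s id"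
    unfolding gen_def by blast
  moreover have "\<pi> \<circ> inv \<pi> = id"
    using assms permutes_inv_o(1) by blast
  ultimately show ?thesis
    unfolding sorts_by_pbi_def by metis
qed

end

theory Submission
  imports Defs "HOL-Combinatorics.Orbits"
begin

text \<open>
  Indexing the black edges by their positions \<open>0..n\<close>, the cycles of the breakpoint graph of
  \<open>\<pi>\<close> become the orbits of the permutation
  \<open>\<sigma> i = \<pi>\<inverse> (\<pi> i + 1) - 1\<close> of \<open>{0..n}\<close>, and \<open>2 g(\<pi>)\<close>
  is the number of transpositions \<open>(0 a)\<close> needed to sort \<open>\<sigma>\<close>. Up to
  conjugation by a permutation fixing 0, a prefix block-interchange multiplies \<open>\<sigma>\<close> by
  \<open>(0 b)(a c)\<close> with \<open>(a c) = (0 a)(0 c)(0 a)\<close>, or, if the blocks are adjacent, by a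
  3-cycle \<open>(0 a)(0 c)\<close>. So it lowers \<open>2 g\<close> by at most 4.
\<close>

section \<open>Orbits and star transpositions\<close>

definition orbits_on :: "'a set \<Rightarrow> ('a \<Rightarrow> 'a) \<Rightarrow> 'a set set" where
  "orbits_on S f = orbit f ` S"

definition fixpoints_on :: "'a set \<Rightarrow> ('a \<Rightarrow> 'a) \<Rightarrow> 'a set" where
  "fixpoints_on S f = {x \<in> S. f x = x}"

lemma finite_orbits_on [simp]: "finite S \<Longrightarrow> finite (orbits_on S f)"
  by (simp add: orbits_on_def)

text \<open>\<open>orbit f x\<close> starts at \<open>f x\<close>, so that \<open>x\<close> itself
  belongs to it depends on \<open>f\<close> permuting a finite set.\<close>

lemma
  assumes "finite S" "f permutes S"
  shows self_in_orbit_permutes: "x \<in> orbit f x"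
    and orbit_eq_permutes: "y \<in> orbit f x \<Longrightarrow> orbit f y = orbit f x"
proof -
  have p: "permutation f" using assms permutation_permutes by blast
  show x: "x \<in> orbit f x" for x
    by (rule permutation_self_in_orbit[OF p])
  show "orbit f y = orbit f x" if "y \<in> orbit f x"
    using that x by (metis orbit_cyclic_eq3 cyclic_on_def)
qed

lemma orbit_subset_closed:
  assumes "f ` A \<subseteq> A" "x \<in> A"
  shows "orbit f x \<subseteq> A"
proof
  fix y assume "y \<in> orbit f x"
  then show "y \<in> A"
    by induction (use assms in auto)
qed

lemma orbits_on_props:
  assumes "finite S" "f permutes S"
  shows "pairwise disjnt (orbits_on S f)"
    and "A \<in> orbits_on S f \<Longrightarrow> A \<subseteq> S"
    and "A \<in> orbits_on S f \<Longrightarrow> A \<noteq> {}"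
    and "A \<in> orbits_on S f \<Longrightarrow> f ` A \<subseteq> A"
    and "A \<in> orbits_on S f \<Longrightarrow> x \<in> A \<Longrightarrow> A = orbit f x"
proof -
  show eq: "A = orbit f x" if "A \<in> orbits_on S f" "x \<in> A" for A x
    using that orbit_eq_permutes[OF assms] by (auto simp: orbits_on_def)
  show "pairwise disjnt (orbits_on S f)"
  proof (rule pairwiseI, unfold disjnt_iff, intro allI notI)
    fix A B x
    assume "A \<in> orbits_on S f" "B \<in> orbits_on S f" "A \<noteq> B" "x \<in> A \<and> x \<in> B"
    then show False using eq[of A x] eq[of B x] by simp
  qed
  show "A \<subseteq> S" if "A \<in> orbits_on S f" for A
    using that orbit_subset_closed[of f S] permutes_image[OF assms(2)]
    by (force simp: orbits_on_def)
  show "A \<noteq> {}" if "A \<in> orbits_on S f" for A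
    using that self_in_orbit_permutes[OF assms] by (auto simp: orbits_on_def)
  show "f ` A \<subseteq> A" if "A \<in> orbits_on S f" for A
    using that by (auto simp: orbits_on_def intro: orbit.step)
qed

text \<open>A nonempty closed set contains the whole orbit of any of its points, and disjoint sets
  give distinct orbits. All lower bounds on numbers of orbits below come from exhibiting such a
  family.\<close>

lemma card_disjoint_closed_le:
  assumes S: "finite S" "f permutes S"
    and A: "\<And>A. A \<in> \<A> \<Longrightarrow> A \<subseteq> S \<and> A \<noteq> {} \<and> f ` A \<subseteq> A"
    and disj: "pairwise disjnt \<A>"
  shows "card \<A> \<le> card (orbits_on S f)"
proof -
  define pick where "pick A = (SOME x. x \<in> A)" for A :: "'a set"
  have pick: "pick A \<in> A" if "A \<in> \<A>" for A
    using A[OF that] by (auto simp: pick_def some_in_eq)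
  have sub: "orbit f (pick A) \<subseteq> A" if "A \<in> \<A>" for A
    using A[OF that] pick[OF that] by (intro orbit_subset_closed) auto
  have "inj_on (\<lambda>A. orbit f (pick A)) \<A>"
  proof (rule inj_onI)
    fix A B assume AB: "A \<in> \<A>" "B \<in> \<A>" "orbit f (pick A) = orbit f (pick B)"
    then have "pick A \<in> A \<inter> B"
      using pick sub self_in_orbit_permutes[OF S, of "pick A"] by blast
    then show "A = B"
      using AB disj by (auto simp: pairwise_def disjnt_def)
  qed
  moreover have "(\<lambda>A. orbit f (pick A)) ` \<A> \<subseteq> orbits_on S f"
    using A pick by (fastforce simp: orbits_on_def)
  ultimately show ?thesis
    using S(1) by (intro card_inj_on_le) auto
qed

section \<open>Effect of one transposition on the orbits\<close>

text \<open>At worst the orbits of \<open>z\<close> and \<open>a\<close> merge: their union stays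
  closed, and every other orbit is untouched.\<close>

lemma card_orbits_on_transpose_ge:
  assumes S: "finite S" "f permutes S" and za: "z \<in> S" "a \<in> S"
  shows "card (orbits_on S f) \<le> card (orbits_on S (transpose z a \<circ> f)) + 1"
proof -
  let ?O = "orbits_on S f" and ?Z = "orbit f z" and ?A = "orbit f a"
  note props = orbits_on_props[OF S]
  have mem: "?Z \<in> ?O" "?A \<in> ?O" "z \<in> ?Z" "a \<in> ?A"
    using za self_in_orbit_permutes[OF S] by (auto simp: orbits_on_def)
  let ?F = "insert (?Z \<union> ?A) (?O - {?Z, ?A})"
  have notin: "?Z \<union> ?A \<notin> ?O - {?Z, ?A}"
    using props(5)[of "?Z \<union> ?A" z] mem by auto
  have "card ?O = card (?O - {?Z, ?A}) + card {?Z, ?A}"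
    using mem(1,2) S(1) card_mono[of ?O "{?Z, ?A}"]
    by (subst card_Diff_subset) (auto simp del: card_insert_disjoint)
  moreover have "card {?Z, ?A} \<le> 2"
    by (simp add: card_insert_if)
  ultimately have "card ?O \<le> card ?F + 1"
    using notin S(1) by simp
  also have "card ?F \<le> card (orbits_on S (transpose z a \<circ> f))"
  proof (rule card_disjoint_closed_le)
    show "transpose z a \<circ> f permutes S"
      using S za by (intro permutes_compose permutes_swap_id) auto
    show "pairwise disjnt ?F"
      using props(1) mem unfolding pairwise_insert by (auto simp: pairwise_def disjnt_def)
    fix B assume B: "B \<in> ?F"
    have "(transpose z a \<circ> f) ` B \<subseteq> B"
    proof (cases "B = ?Z \<union> ?A")
      case True
      then show ?thesis
        using props(4) mem by (fastforce simp: transpose_def)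
    next
      case False
      then have BO: "B \<in> ?O" "B \<noteq> ?Z" "B \<noteq> ?A" using B by auto
      then have "z \<notin> B" "a \<notin> B" using props(5) by blast+
      then show ?thesis
        using props(4)[OF BO(1)] by (fastforce simp: transpose_def)
    qed
    then show "B \<subseteq> S \<and> B \<noteq> {} \<and> (transpose z a \<circ> f) ` B \<subseteq> B"
      using B props(2,3) mem by blast
  qed (fact S)
  finally show ?thesis by simp
qed

text \<open>The new map sends \<open>a\<close> to \<open>a\<close>, so \<open>{a}\<close> splits off
  the orbit of \<open>z\<close>, and the rest of that orbit remains closed and contains
  \<open>z\<close>.\<close>

lemma card_orbits_on_transpose_split:
  assumes S: "finite S" "f permutes S" and za: "z \<in> S" "a \<in> S" "a \<noteq> z" "f a = z"
  shows "card (orbits_on S f) + 1 \<le> card (orbits_on S (transpose z a \<circ> f))"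
proof -
  let ?O = "orbits_on S f" and ?Z = "orbit f z"
  note props = orbits_on_props[OF S]
  have mem: "?Z \<in> ?O" "z \<in> ?Z"
    using za self_in_orbit_permutes[OF S] by (auto simp: orbits_on_def)
  have "z \<in> orbit f a" using za(4) orbit.base[of f a] by simp
  then have "a \<in> ?Z"
    using self_in_orbit_permutes[OF S, of a] orbit_eq_permutes[OF S, of z a] by simp
  let ?F = "insert {a} (insert (?Z - {a}) (?O - {?Z}))"
  have disj: "B \<inter> ?Z = {}" if "B \<in> ?O - {?Z}" for B
    using that props(1) mem by (auto simp: pairwise_def disjnt_def)
  have "?Z - {a} \<notin> ?O - {?Z}" "{a} \<notin> insert (?Z - {a}) (?O - {?Z})"
    using disj[of "?Z - {a}"] disj[of "{a}"] mem(2) \<open>a \<in> ?Z\<close> za(3) by (safe; fast)+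
  moreover have "card ?O = Suc (card (?O - {?Z}))"
    using S(1) mem(1) by (intro card.remove) auto
  ultimately have "card ?O + 1 = card ?F"
    using S(1) by (simp del: card_Diff_singleton)
  also have "card ?F \<le> card (orbits_on S (transpose z a \<circ> f))"
  proof (rule card_disjoint_closed_le)
    show "transpose z a \<circ> f permutes S"
      using S za by (intro permutes_compose permutes_swap_id) auto
    show "pairwise disjnt ?F"
    proof -
      have "disjnt {a} B" "disjnt (?Z - {a}) B" if "B \<in> ?O - {?Z}" for B
        using disj[OF that] \<open>a \<in> ?Z\<close> by (auto simp: disjnt_def)
      then show ?thesis
        using pairwise_subset[OF props(1), of "?O - {?Z}"]
        by (auto simp: pairwise_insert disjnt_sym)
    qed
    fix B assume B: "B \<in> ?F"
    \<comment> \<open>Only \<open>a\<close> is mapped to \<open>z\<close>, so no other point is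
      redirected to \<open>a\<close>; this keeps \<open>?Z - {a}\<close> closed.\<close>
    have inj: "f x = z \<longleftrightarrow> x = a" for x
      using inj_eq[OF permutes_inj[OF S(2)], of x a] za(4) by simp
    consider "B = {a}" | "B = ?Z - {a}" | "B \<in> ?O" "B \<noteq> ?Z" using B by auto
    then have "(transpose z a \<circ> f) ` B \<subseteq> B"
    proof cases
      case 2
      have "transpose z a (f x) \<in> ?Z - {a}" if "x \<in> ?Z" "x \<noteq> a" for x
        using props(4)[OF mem(1)] mem(2) inj[of x] za(3) that
        by (auto simp: transpose_def image_subset_iff)
      then show ?thesis using 2 by auto
    next
      case 3
      then have "z \<notin> B" "a \<notin> B" using disj[of B] mem(2) \<open>a \<in> ?Z\<close> by blast+
      then show ?thesis
        using props(4)[OF 3(1)] by (fastforce simp: transpose_def)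
    qed (simp add: za(4))
    then show "B \<subseteq> S \<and> B \<noteq> {} \<and> (transpose z a \<circ> f) ` B \<subseteq> B"
      using B props(2)[of B] props(3)[of B] props(2)[OF mem(1)] mem(2) za(2,3) by auto
  qed (fact S)
  finally show ?thesis .
qed

text \<open>The distance of \<open>f\<close> from the identity in the Cayley graph generated by the
  transpositions \<open>(z a)\<close>. The usual formula \<open>card S + c - 2 * c\<^sub>1 - (if f z = z then 0 else 2)\<close>
  takes this form because a fixed point \<open>z\<close> is not counted here.\<close>

definition star_cost :: "'a set \<Rightarrow> 'a \<Rightarrow> ('a \<Rightarrow> 'a) \<Rightarrow> int" where
  "star_cost S z f =
     int (card S) + int (card (orbits_on S f)) - 2 * int (card (fixpoints_on (S - {z}) f)) - 2"

text \<open>The only possible new fixed point other than \<open>z\<close> is \<open>a\<close>, and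
  only if \<open>f a = z\<close>. Then the loss of 2 is offset by an additional orbit. Otherwise no
  fixed point is gained and at most one orbit is lost.\<close>

lemma star_cost_transpose:
  assumes S: "finite S" "f permutes S" and za: "z \<in> S" "a \<in> S" "a \<noteq> z"
  shows "star_cost S z f \<le> star_cost S z (transpose z a \<circ> f) + 1"
proof -
  let ?f = "transpose z a \<circ> f" and ?X = "fixpoints_on (S - {z})"
  have X: "?X ?f \<subseteq> insert a (?X f)"
    by (auto simp: fixpoints_on_def transpose_def split: if_splits)
  have fin: "finite (?X f)" using S(1) by (simp add: fixpoints_on_def)
  show ?thesis
  proof (cases "f a = z")
    case True
    have "card (?X ?f) \<le> card (?X f) + 1"
      using card_mono[OF _ X] fin by (simp add: card_insert_if split: if_splits)
    then show ?thesis
      using card_orbits_on_transpose_split[OF S za True] by (simp add: star_cost_def)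
  next
    case False
    then have "?X ?f \<subseteq> ?X f"
      using X za by (auto simp: fixpoints_on_def transpose_def split: if_splits)
    then have "card (?X ?f) \<le> card (?X f)" using fin by (rule card_mono[rotated])
    then show ?thesis
      using card_orbits_on_transpose_ge[OF S za(1,2)] by (simp add: star_cost_def)
  qed
qed

text \<open>Preimages under \<open>h\<close> of orbits of \<open>f'\<close> are disjoint sets closed
  under \<open>f\<close>, and \<open>h\<close> carries fixed points of \<open>f\<close> to fixed
  points of \<open>f'\<close>. As \<open>h z = z\<close>, the excluded point is respected.\<close>

lemma star_cost_conj:
  assumes S: "finite S" "f permutes S" "h permutes S" and z: "h z = z"
    and conj: "\<And>x. x \<in> S \<Longrightarrow> h (f x) = f' (h x)" and f': "f' permutes S"
  shows "star_cost S z f' \<le> star_cost S z f"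
proof -
  note props = orbits_on_props[OF S(1) f']
  have h: "bij h" using S(3) by (rule permutes_bij)
  have "card (orbits_on S f') = card ((\<lambda>A. h -` A) ` orbits_on S f')"
    by (rule card_image[symmetric]) (metis bij_is_surj h inj_onI surj_image_vimage_eq)
  also have "\<dots> \<le> card (orbits_on S f)"
  proof (rule card_disjoint_closed_le[OF S(1,2)])
    show "pairwise disjnt ((\<lambda>A. h -` A) ` orbits_on S f')"
      using props(1) by (fastforce simp: pairwise_def disjnt_def)
    fix B assume "B \<in> (\<lambda>A. h -` A) ` orbits_on S f'"
    then obtain A where A: "A \<in> orbits_on S f'" "B = h -` A" by blast
    have "B \<subseteq> S" using A props(2) permutes_in_image[OF S(3)] by blast
    moreover have "B \<noteq> {}"
      using A props(3) bij_is_surj[OF h] by (metis surj_image_vimage_eq image_empty)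
    moreover have "f ` B \<subseteq> B"
      using A conj \<open>B \<subseteq> S\<close> props(4)[OF A(1)] by (fastforce simp: image_subset_iff)
    ultimately show "B \<subseteq> S \<and> B \<noteq> {} \<and> f ` B \<subseteq> B" by blast
  qed
  finally have "card (orbits_on S f') \<le> card (orbits_on S f)" .
  moreover have "card (fixpoints_on (S - {z}) f) \<le> card (fixpoints_on (S - {z}) f')"
  proof (rule card_inj_on_le[of h])
    show "inj_on h (fixpoints_on (S - {z}) f)"
      using h by (meson bij_is_inj inj_on_subset subset_UNIV)
    have "h x \<noteq> z" if "x \<noteq> z" for x
      using that z bij_is_inj[OF h] by (metis injD)
    then show "h ` fixpoints_on (S - {z}) f \<subseteq> fixpoints_on (S - {z}) f'"
      using permutes_in_image[OF S(3)] by (force simp: fixpoints_on_def simp flip: conj)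
    show "finite (fixpoints_on (S - {z}) f')"
      using S(1) by (simp add: fixpoints_on_def)
  qed
  ultimately show ?thesis by (simp add: star_cost_def)
qed

section \<open>The permutation of the black edges\<close>

text \<open>The blocks have lengths \<open>w + 1\<close>, \<open>u\<close> and \<open>v + 1\<close>.
  Parametrising by lengths builds in the order of the borders and reduces every later case to linear
  arithmetic.\<close>

lemma block_interchange_1_apply:
  assumes "w + u + v + 2 \<le> n"
  shows "block_interchange n 1 (w + 2) (w + u + 2) (w + u + v + 3) p =
    (if p = 0 \<or> w + u + v + 3 \<le> p then p
     else if p \<le> v + 1 then p + w + u + 1
     else if p \<le> u + v + 1 then p + w - v
     else p - (u + v + 1))"
proof -
  from assms obtain m where n: "n = w + u + v + 2 + m" by (auto simp: le_iff_add)
  define A where "A = [w + u + 2..<w + u + v + 3]"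
  define B where "B = [w + 2..<w + u + 2]"
  define C where "C = [1..<w + 2]"
  define D where "D = [w + u + v + 3..<n + 1]"
  have len: "length A = v + 1" "length B = u" "length C = w + 1" "length D = m"
    by (simp_all add: n A_def B_def C_def D_def del: upt_Suc)
  have nth: "q < v + 1 \<Longrightarrow> A ! q = w + u + 2 + q" "q < u \<Longrightarrow> B ! q = w + 2 + q"
    "q < w + 1 \<Longrightarrow> C ! q = 1 + q" "q < m \<Longrightarrow> D ! q = w + u + v + 3 + q" for q
    by (simp_all add: n A_def B_def C_def D_def del: upt_Suc)
  have "perm_of_list (A @ B @ C @ D) p =
    (if p = 0 \<or> w + u + v + 3 \<le> p then p
     else if p \<le> v + 1 then p + w + u + 1
     else if p \<le> u + v + 1 then p + w - v
     else p - (u + v + 1))"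
  proof (cases p)
    case (Suc q)
    consider "q < v + 1" | "v + 1 \<le> q" "q < u + v + 1" | "u + v + 1 \<le> q" "q < w + u + v + 2"
      | "w + u + v + 2 \<le> q" "q < n" | "n \<le> q"
      by linarith
    then show ?thesis
    proof cases
      case 1
      then show ?thesis
        unfolding Suc by (simp add: perm_of_list_def nth_append len nth)
    next
      case 2
      then obtain r where "q = v + 1 + r" "r < u" by (auto simp: le_iff_add)
      then show ?thesis
        unfolding Suc by (simp add: perm_of_list_def nth_append len nth)
    next
      case 3
      then obtain r where "q = u + v + 1 + r" "r < w + 1" by (auto simp: le_iff_add)
      then show ?thesis
        unfolding Suc by (simp add: perm_of_list_def nth_append len nth)
    next
      case 4
      then obtain r where "q = w + u + v + 2 + r" by (auto simp: le_iff_add)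
      then show ?thesis
        using 4 unfolding n Suc by (simp add: perm_of_list_def nth_append len nth)
    next
      case 5
      then show ?thesis
        unfolding n Suc by (simp add: perm_of_list_def len)
    qed
  qed (simp add: perm_of_list_def)
  then show ?thesis
    by (simp add: block_interchange_def A_def B_def C_def D_def del: upt_Suc)
qed

lemma perm_of_list_permutes:
  assumes "distinct xs" "set xs = {1..length xs}"
  shows "perm_of_list xs permutes {1..length xs}"
proof (rule bij_imp_permutes)
  have "bij_betw (\<lambda>p. p - 1) {1..length xs} {..<length xs}"
    by (rule bij_betw_byWitness[where f' = Suc]) auto
  then have "bij_betw ((!) xs \<circ> (\<lambda>p. p - 1)) {1..length xs} {1..length xs}"
    using bij_betw_nth[OF assms(1) refl assms(2)[symmetric]] by (rule bij_betw_trans)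
  then show "bij_betw (perm_of_list xs) {1..length xs} {1..length xs}"
    by (rule bij_betw_cong[THEN iffD1, rotated]) (simp add: perm_of_list_def)
qed (auto simp: perm_of_list_def)

lemma block_interchange_1_permutes:
  assumes "1 < j" "j \<le> k" "k < l" "l \<le> n + 1"
  shows "block_interchange n 1 j k l permutes {1..n}"
proof -
  let ?xs = "[1..<1] @ [k..<l] @ [j..<k] @ [1..<j] @ [l..<n+1]"
  have "distinct ?xs" "length ?xs = n" "set ?xs = {1..n}"
    using assms by (auto simp del: upt_Suc)
  then show ?thesis
    using perm_of_list_permutes[of ?xs] by (simp add: block_interchange_def)
qed

text \<open>On \<open>{0..n}\<close>, the black edges indexed by position, this follows a black edge and then
  the grey edge leaving its left end \<open>2 * \<pi> i\<close>.\<close>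

definition next_black :: "(nat \<Rightarrow> nat) \<Rightarrow> nat \<Rightarrow> nat" where
  "next_black \<pi> i = inv \<pi> (Suc (\<pi> i)) - 1"

lemma permutes_1_0: "\<pi> permutes {1..n} \<Longrightarrow> \<pi> 0 = (0::nat)"
  by (rule permutes_not_in, assumption) simp

lemma permutes_1_eq_0_iff:
  assumes "\<pi> permutes {1..n}"
  shows "\<pi> i = (0::nat) \<longleftrightarrow> i = 0"
  using permutes_1_0[OF assms] inj_eq[OF permutes_inj[OF assms], of i 0] by simp

text \<open>The subtraction in \<open>next_black\<close> is never truncated, because
  \<open>inv \<pi>\<close> sends no positive number to 0.\<close>

lemma Suc_next_black:
  assumes "\<pi> permutes {1..n}"
  shows "Suc (next_black \<pi> i) = inv \<pi> (Suc (\<pi> i))"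
  using permutes_1_eq_0_iff[OF permutes_inv[OF assms], of "Suc (\<pi> i)"]
  by (simp add: next_black_def)

lemma next_black_eqI:
  assumes "\<pi> permutes {1..n}" "\<pi> (Suc m) = Suc (\<pi> i)"
  shows "next_black \<pi> i = m"
  by (simp add: next_black_def permutes_inverses[OF assms(1)] flip: assms(2))

lemma apply_Suc_next_black:
  assumes "\<pi> permutes {1..n}"
  shows "\<pi> (Suc (next_black \<pi> i)) = Suc (\<pi> i)"
  by (simp add: Suc_next_black[OF assms] permutes_inverses[OF assms])

lemma permutes_1_imp_permutes_0:
  assumes "\<pi> permutes {1..n}"
  shows "\<pi> permutes {0..n::nat}"
  using assms by (rule permutes_subset) auto

lemma next_black_permutes:
  assumes "\<pi> permutes {1..n}"
  shows "next_black \<pi> permutes {0..n}"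
proof (rule bij_imp_permutes)
  note p0 = permutes_1_imp_permutes_0[OF assms]
  show "next_black \<pi> x = x" if "x \<notin> {0..n}" for x
    using that permutes_not_in[OF assms] by (intro next_black_eqI[OF assms]) auto
  have "inj_on (next_black \<pi>) {0..n}"
    by (rule inj_onI) (metis apply_Suc_next_black[OF assms] Suc_inject injD permutes_inj[OF assms])
  moreover have "next_black \<pi> x \<in> {0..n}" if "x \<in> {0..n}" for x
  \<comment> \<open>If the value \<open>m\<close> exceeded \<open>n\<close>, then
    \<open>\<pi>\<close> would fix \<open>Suc m\<close>, giving
    \<open>m = \<pi> x \<le> n\<close>.\<close>
  proof (rule ccontr)
    assume "next_black \<pi> x \<notin> {0..n}"
    then show False
      using apply_Suc_next_black[OF assms, of x] permutes_not_in[OF assms, of "Suc (next_black \<pi> x)"]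
        permutes_in_image[OF p0, of x] that by auto
  qed
  ultimately show "bij_betw (next_black \<pi>) {0..n} {0..n}"
    using endo_inj_surj[of "{0..n}" "next_black \<pi>"]
    by (auto simp: bij_betw_def image_subset_iff)
qed

section \<open>Effect of a prefix block-interchange on the cost\<close>

text \<open>Only the block borders create new neighbours. With \<open>a = j - 1\<close>,
  \<open>b = k - 1\<close>, \<open>c = l - 1\<close>, the four factors multiply to
  \<open>(0 b)(a c)\<close>, and for adjacent blocks the two factors form a 3-cycle on
  \<open>0, a, c\<close>.\<close>

lemma block_interchange_left_neighbour:
  assumes jkl: "1 < j" "j \<le> k" "k < l" "l \<le> n + 1"
  defines "\<beta> \<equiv> block_interchange n 1 j k l" and "t \<equiv> transpose 0"
  shows "j < k \<Longrightarrow> t (k - 1) (t (j - 1) (t (l - 1) (t (j - 1) (\<beta> (Suc p) - 1)))) = \<beta> p"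
    and "j = k \<Longrightarrow> t (j - 1) (t (l - 1) (\<beta> (Suc p) - 1)) = \<beta> p"
proof -
  obtain u v w where uvw: "j = w + 2" "k = w + u + 2" "l = w + u + v + 3"
  proof
    show "j = j - 2 + 2" "k = j - 2 + (k - j) + 2"
      "l = j - 2 + (k - j) + (l - k - 1) + 3"
      using jkl by simp_all
  qed
  have \<beta>: "\<beta> p =
    (if p = 0 \<or> w + u + v + 3 \<le> p then p
     else if p \<le> v + 1 then p + w + u + 1
     else if p \<le> u + v + 1 then p + w - v
     else p - (u + v + 1))" for p
    using block_interchange_1_apply[of w u v n p] jkl(4) unfolding \<beta>_def uvw by simp
  consider "p = 0" | "0 < p" "p \<le> v" | "p = v + 1" | "v + 1 < p" "p \<le> u + v"
    | "0 < u" "p = u + v + 1" | "u + v + 1 < p" "p < w + u + v + 2" | "p = w + u + v + 2"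
    | "w + u + v + 3 \<le> p"
    by linarith
  \<comment> \<open>The new adjacencies are \<open>0|k\<close>, \<open>l-1|j\<close>,
    \<open>k-1|1\<close> and \<open>j-1|l\<close>; an empty middle block replaces the two in the
    middle by \<open>l-1|1\<close>. Elsewhere
    \<open>\<beta> (Suc p) = Suc (\<beta> p)\<close>.\<close>
  then have neighbour: "\<beta> p = 0 \<and> \<beta> (Suc p) - 1 = k - 1
    \<or> \<beta> p = l - 1 \<and> \<beta> (Suc p) - 1 = (if u = 0 then 0 else j - 1)
    \<or> u \<noteq> 0 \<and> \<beta> p = k - 1 \<and> \<beta> (Suc p) - 1 = 0
    \<or> \<beta> p = j - 1 \<and> \<beta> (Suc p) - 1 = l - 1
    \<or> \<beta> (Suc p) - 1 = \<beta> p \<and> \<beta> p \<notin> {0, j - 1, k - 1, l - 1}"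
    unfolding uvw by cases (simp_all add: \<beta>, linarith+)
  define x y where "x = \<beta> (Suc p) - 1" and "y = \<beta> p"
  note neighbour = neighbour[folded x_def y_def]
  have "t (k - 1) (t (j - 1) (t (l - 1) (t (j - 1) x))) = y" if "j < k"
    using neighbour that unfolding uvw t_def by (elim disjE) (simp_all add: transpose_def)
  then show "t (k - 1) (t (j - 1) (t (l - 1) (t (j - 1) (\<beta> (Suc p) - 1)))) = \<beta> p" if "j < k"
    using that unfolding x_def y_def .
  have "t (j - 1) (t (l - 1) x) = y" if "j = k"
    using neighbour that unfolding uvw t_def by (elim disjE) (simp_all add: transpose_def)
  then show "t (j - 1) (t (l - 1) (\<beta> (Suc p) - 1)) = \<beta> p" if "j = k"
    using that unfolding x_def y_def .
qed

text \<open>Conjugating by \<open>\<beta>\<close>, the effect of a block-interchange \<open>\<beta>\<close> on \<^const>\<open>next_black\<close>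
  is a multiplication by the map taking \<open>x\<close> to the left neighbour of \<open>x + 1\<close> in \<open>\<beta>\<close>.\<close>

lemma next_black_comp:
  assumes \<pi>: "\<pi> permutes {1..n}" and \<beta>: "\<beta> permutes {1..n}"
    and \<tau>: "\<And>p. p \<le> n \<Longrightarrow> \<tau> (\<beta> (Suc p) - 1) = \<beta> p" and x: "x \<le> n"
  shows "\<beta> (next_black (\<pi> \<circ> \<beta>) x) = (\<tau> \<circ> next_black \<pi>) (\<beta> x)"
proof -
  let ?m = "next_black (\<pi> \<circ> \<beta>) x"
  have comp: "\<pi> \<circ> \<beta> permutes {1..n}" using permutes_compose[OF \<beta> \<pi>] .
  have "\<pi> (\<beta> (Suc ?m)) = Suc (\<pi> (\<beta> x))"
    using apply_Suc_next_black[OF comp, of x] by simp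
  \<comment> \<open>Nonzero, so that subtracting 1 really gives the predecessor.\<close>
  moreover have "\<beta> (Suc ?m) \<noteq> 0"
    using permutes_1_eq_0_iff[OF \<beta>] by simp
  ultimately have "next_black \<pi> (\<beta> x) = \<beta> (Suc ?m) - 1"
    by (intro next_black_eqI[OF \<pi>]) simp
  moreover have "?m \<le> n"
    using permutes_in_image[OF next_black_permutes[OF comp], of x] x by simp
  ultimately show ?thesis using \<tau> by simp
qed

text \<open>\<open>\<beta>\<close> conjugates \<open>next_black (\<pi> \<circ> \<beta>)\<close> to
  \<open>next_black \<pi>\<close> followed by four or two star transpositions, each of which lowers
  the cost by at most 1.\<close>

lemma star_cost_next_black_comp:
  assumes \<pi>: "\<pi> permutes {1..n}" and \<beta>: "\<beta> \<in> prefix_block_interchanges n"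
  shows "star_cost {0..n} 0 (next_black \<pi>) \<le> star_cost {0..n} 0 (next_black (\<pi> \<circ> \<beta>)) + 4"
proof -
  from \<beta> obtain j k l where jkl: "1 < j" "j \<le> k" "k < l" "l \<le> n + 1"
    and \<beta>_eq: "\<beta> = block_interchange n 1 j k l"
    unfolding prefix_block_interchanges_def by auto
  have perm: "\<beta> permutes {1..n}"
    unfolding \<beta>_eq using jkl by (rule block_interchange_1_permutes)
  let ?t = "transpose (0::nat)"
  let ?f = "next_black \<pi>"
  have f: "?f permutes {0..n}" using next_black_permutes[OF \<pi>] .
  have t: "?t a \<circ> h permutes {0..n}" if "a \<in> {1..n}" "h permutes {0..n}" for a h
    using that by (intro permutes_compose permutes_swap_id) auto
  have cost: "star_cost {0..n} 0 h \<le> star_cost {0..n} 0 (?t a \<circ> h) + 1"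
    if "a \<in> {1..n}" "h permutes {0..n}" for a h
    using that by (intro star_cost_transpose) auto
  have conj: "star_cost {0..n} 0 (\<tau> \<circ> ?f) \<le> star_cost {0..n} 0 (next_black (\<pi> \<circ> \<beta>))"
    if "\<And>p. p \<le> n \<Longrightarrow> \<tau> (\<beta> (Suc p) - 1) = \<beta> p" "\<tau> \<circ> ?f permutes {0..n}" for \<tau>
    using that permutes_1_imp_permutes_0[OF perm] permutes_1_0[OF perm]
      next_black_permutes[OF permutes_compose[OF perm \<pi>]]
    by (intro star_cost_conj[where h = \<beta>] next_black_comp[OF \<pi> perm]) auto
  have mem: "j - 1 \<in> {1..n}" "k - 1 \<in> {1..n}" "l - 1 \<in> {1..n}" using jkl by auto
  show ?thesis
  proof (cases "j < k")
    case True
    let ?\<tau> = "?t (k - 1) \<circ> (?t (j - 1) \<circ> (?t (l - 1) \<circ> ?t (j - 1)))"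
    have perm\<tau>: "?t (k - 1) \<circ> (?t (j - 1) \<circ> (?t (l - 1) \<circ> (?t (j - 1) \<circ> ?f))) permutes {0..n}"
      by (intro t mem f)
    have "?\<tau> (\<beta> (Suc p) - 1) = \<beta> p" if "p \<le> n" for p
      using block_interchange_left_neighbour(1)[OF jkl True, folded \<beta>_eq] by simp
    then have "star_cost {0..n} 0 (?\<tau> \<circ> ?f) \<le> star_cost {0..n} 0 (next_black (\<pi> \<circ> \<beta>))"
      using perm\<tau> by (intro conj) (auto simp: comp_assoc)
    \<comment> \<open>The transpositions are applied one at a time, the innermost first.\<close>
    moreover have "star_cost {0..n} 0 ?f \<le> star_cost {0..n} 0 (?\<tau> \<circ> ?f) + 4"
      unfolding comp_assoc
      using cost[OF mem(1) f] cost[OF mem(3) t[OF mem(1) f]]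
        cost[OF mem(1) t[OF mem(3) t[OF mem(1) f]]]
        cost[OF mem(2) t[OF mem(1) t[OF mem(3) t[OF mem(1) f]]]]
      by linarith
    ultimately show ?thesis by linarith
  next
    case False
    then have "j = k" using jkl by simp
    let ?\<tau> = "?t (j - 1) \<circ> ?t (l - 1)"
    have perm\<tau>: "?t (j - 1) \<circ> (?t (l - 1) \<circ> ?f) permutes {0..n}"
      by (intro t mem f)
    have "?\<tau> (\<beta> (Suc p) - 1) = \<beta> p" if "p \<le> n" for p
      using block_interchange_left_neighbour(2)[OF jkl \<open>j = k\<close>, folded \<beta>_eq] by simp
    then have "star_cost {0..n} 0 (?\<tau> \<circ> ?f) \<le> star_cost {0..n} 0 (next_black (\<pi> \<circ> \<beta>))"
      using perm\<tau> by (intro conj) (auto simp: comp_assoc)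
    moreover have "star_cost {0..n} 0 ?f \<le> star_cost {0..n} 0 (?\<tau> \<circ> ?f) + 2"
      unfolding comp_assoc using cost[OF mem(3) f] cost[OF mem(1) t[OF mem(3) f]] by linarith
    ultimately show ?thesis by linarith
  qed
qed

section \<open>The cost along a sorting sequence\<close>

lemma next_black_id [simp]: "next_black id = id"
  by (simp add: next_black_def fun_eq_iff)

lemma star_cost_id:
  assumes "finite S" "z \<in> S"
  shows "star_cost S z id = 0"
proof -
  have "orbit id x = {x}" for x :: 'a
    by (auto elim: orbit.induct intro: orbit.base[of id x, simplified])
  then have "orbits_on S id = (\<lambda>x. {x}) ` S"
    by (simp add: orbits_on_def)
  moreover have "fixpoints_on (S - {z}) id = S - {z}"
    by (auto simp: fixpoints_on_def)
  \<comment> \<open>Nonemptiness makes the natural number \<open>card S - 1\<close> of counted fixed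
    points exact, and the terms cancel.\<close>
  moreover have "card S > 0" using assms by (auto simp: card_gt_0_iff)
  ultimately show ?thesis
    using assms by (simp add: star_cost_def card_image of_nat_diff)
qed

text \<open>The head of the list acts first, and its tail sorts
  \<open>\<pi> \<circ> \<beta>\<close>; hence the induction generalises
  \<open>\<pi>\<close>.\<close>

lemma star_cost_le_length:
  assumes "sorts_by_pbi n \<pi> \<beta>s" "\<pi> permutes {1..n}"
  shows "star_cost {0..n} 0 (next_black \<pi>) \<le> 4 * int (length \<beta>s)"
  using assms
proof (induction \<beta>s arbitrary: \<pi>)
  case Nil
  then have "\<pi> = id" by (simp add: sorts_by_pbi_def)
  then have "star_cost {0..n} 0 (next_black \<pi>) = 0"
    by (simp only: next_black_id star_cost_id finite_atLeastAtMost atLeastAtMost_iff le0)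
  then show ?case by simp
next
  case (Cons \<beta> \<beta>s)
  then have \<beta>: "\<beta> \<in> prefix_block_interchanges n" and "sorts_by_pbi n (\<pi> \<circ> \<beta>) \<beta>s"
    by (auto simp: sorts_by_pbi_def comp_assoc)
  moreover have "\<beta> permutes {1..n}"
    using \<beta> block_interchange_1_permutes unfolding prefix_block_interchanges_def by blast
  ultimately have "star_cost {0..n} 0 (next_black (\<pi> \<circ> \<beta>)) \<le> 4 * int (length \<beta>s)"
    using Cons.prems(2) by (intro Cons.IH permutes_compose)
  then show ?case
    using star_cost_next_black_comp[OF Cons.prems(2) \<beta>] by simp
qed

section \<open>Cycles of the breakpoint graph\<close>

text \<open>The values \<open>\<pi> 0 = 0\<close> and \<open>\<pi> (n + 1) = n + 1\<close> supply
  the frame vertices 0 and \<open>2 * n + 1\<close>, so the extreme positions need no special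
  case.\<close>

definition black_edge :: "(nat \<Rightarrow> nat) \<Rightarrow> nat \<Rightarrow> nat set" where
  "black_edge \<pi> i = {2 * \<pi> i, 2 * \<pi> (Suc i) - 1}"

lemma breakpoint_graph_eq:
  assumes "\<pi> permutes {1..n}"
  shows "breakpoint_graph n \<pi> =
    {(Black, black_edge \<pi> i) | i. i \<le> n} \<union> {(Grey, {2 * i, 2 * i + 1}) | i. i \<le> n}"
proof -
  have "{bp_vertex n \<pi> (2 * i), bp_vertex n \<pi> (2 * i + 1)} = black_edge \<pi> i" if "i \<le> n" for i
  proof -
    have "bp_vertex n \<pi> (2 * i) = 2 * \<pi> i"
      using that permutes_1_0[OF assms] by (auto simp: bp_vertex_def)
    moreover have "bp_vertex n \<pi> (2 * i + 1) = 2 * \<pi> (Suc i) - 1"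
      using that permutes_not_in[OF assms, of "Suc n"] by (auto simp: bp_vertex_def)
    ultimately show ?thesis by (simp add: black_edge_def)
  qed
  then have "{(Black, {bp_vertex n \<pi> (2 * i), bp_vertex n \<pi> (2 * i + 1)}) | i. i \<le> n} =
      {(Black, black_edge \<pi> i) | i. i \<le> n}"
    unfolding setcompr_eq_image by (intro image_cong) auto
  then show ?thesis
    unfolding breakpoint_graph_def by simp
qed

lemma finite_breakpoint_graph [simp]: "finite (breakpoint_graph n \<pi>)"
  by (simp add: breakpoint_graph_def)

section \<open>Uniqueness of the cycle through an edge\<close>

text \<open>Left ends are even and right ends odd, so a common vertex lies on the same side of both
  edges and injectivity of \<open>\<pi>\<close> applies.\<close>

lemma black_edge_unique:
  assumes \<pi>: "\<pi> permutes {1..n}" and v: "v \<in> black_edge \<pi> i" "v \<in> black_edge \<pi> j"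
  shows "i = j"
proof -
  have pos: "\<pi> (Suc m) > 0" for m
    using permutes_1_eq_0_iff[OF \<pi>, of "Suc m"] by simp
  have parity: "2 * a \<noteq> 2 * b - (1::nat)" if "b > 0" for a b
    using that by presburger
  have "\<pi> i = \<pi> j \<or> \<pi> (Suc i) = \<pi> (Suc j)"
    using v pos[of i] pos[of j] parity[OF pos] parity[OF pos, THEN not_sym] unfolding black_edge_def
    by (auto simp del: One_nat_def)
  then show ?thesis
    by (simp add: inj_eq[OF permutes_inj[OF \<pi>]])
qed

lemma breakpoint_graph_edge_unique:
  assumes \<pi>: "\<pi> permutes {1..n}"
    and "(c, e) \<in> breakpoint_graph n \<pi>" "(c, e') \<in> breakpoint_graph n \<pi>" "v \<in> e" "v \<in> e'"
  shows "e = e'"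
proof (cases c)
  case Black
  then show ?thesis
    using assms(2-) black_edge_unique[OF \<pi>] unfolding breakpoint_graph_eq[OF \<pi>] by blast
next
  case Grey
  then obtain i j where "e = {2 * i, 2 * i + 1}" "e' = {2 * j, 2 * j + 1}"
    using assms(2,3) unfolding breakpoint_graph_eq[OF \<pi>] by blast
  moreover from this have "i = j" using assms(4,5) by auto
  ultimately show ?thesis by simp
qed

text \<open>The edges entering and leaving a vertex of the walk have opposite colours, so both
  colours occur there.\<close>

lemma closed_walk_edges_at_vertex:
  assumes "even (length vs)" "e \<in> closed_walk_edges vs" "v \<in> snd e"
  shows "\<exists>e'. (c, e') \<in> closed_walk_edges vs \<and> v \<in> e'"
proof -
  let ?L = "length vs"
  let ?col = "\<lambda>m::nat. if even m then Black else Grey"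
  let ?e = "\<lambda>m. {vs ! m, vs ! (Suc m mod ?L)}"
  from assms(2,3) obtain m' where "m' < ?L" "v = vs ! m' \<or> v = vs ! (Suc m' mod ?L)"
    unfolding closed_walk_edges_def by auto
  then obtain m where m: "m < ?L" "v = vs ! m"
    by (metis mod_less_divisor less_nat_zero_code gr0I)
  \<comment> \<open>The cyclic predecessor of \<open>m\<close>. At the wrap-around, even length
    makes \<open>?L - 1\<close> odd, so the colours still alternate.\<close>
  define p where "p = (if m = 0 then ?L - 1 else m - 1)"
  have p: "p < ?L" "Suc p mod ?L = m"
    using m by (auto simp: p_def)
  have "?col p \<noteq> ?col m"
    using m assms(1) by (auto simp: p_def)
  moreover have "(?col m, ?e m) \<in> closed_walk_edges vs" "(?col p, ?e p) \<in> closed_walk_edges vs"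
    unfolding closed_walk_edges_def using m p by blast+
  moreover have "v \<in> ?e m" "v \<in> ?e p" using m p by auto
  moreover have "c = ?col m \<or> c = ?col p"
    using \<open>?col p \<noteq> ?col m\<close> by (cases c) (auto split: if_splits)
  ultimately show ?thesis by fastforce
qed

lemma alternating_cycle_at_vertex:
  assumes "C \<in> alternating_cycles E" "e \<in> C" "v \<in> snd e"
  shows "\<exists>e'. (c, e') \<in> C \<and> v \<in> e'"
proof -
  obtain vs where "C = closed_walk_edges vs" "even (length vs)"
    using assms(1) unfolding alternating_cycles_def by blast
  then show ?thesis
    using closed_walk_edges_at_vertex[of vs e v c] assms(2,3) by simp
qed

text \<open>Follow \<open>C\<close> from the common edge: at each vertex, \<open>C'\<close> has an
  edge of the colour that \<open>C\<close> uses next, and the graph has only one such edge.\<close>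

lemma alternating_cycle_subset:
  assumes \<pi>: "\<pi> permutes {1..n}"
    and C: "C \<in> alternating_cycles (breakpoint_graph n \<pi>)"
    and C': "C' \<in> alternating_cycles (breakpoint_graph n \<pi>)"
    and e: "e \<in> C" "e \<in> C'"
  shows "C \<subseteq> C'"
proof -
  let ?E = "breakpoint_graph n \<pi>"
  from C obtain vs where vs: "C = closed_walk_edges vs" "even (length vs)" "C \<subseteq> ?E"
    unfolding alternating_cycles_def by blast
  have C'E: "C' \<subseteq> ?E" using C' unfolding alternating_cycles_def by blast
  let ?L = "length vs"
  let ?e = "\<lambda>m. (if even m then Black else Grey, {vs ! m, vs ! (Suc m mod ?L)})"
  have C_eq: "C = {?e m | m. m < ?L}" unfolding vs closed_walk_edges_def ..
  from e obtain m0 where m0: "m0 < ?L" "?e m0 \<in> C'" unfolding C_eq by blast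
  have step: "?e (Suc m mod ?L) \<in> C'" if m: "m < ?L" "?e m \<in> C'" for m
  proof -
    let ?m = "Suc m mod ?L"
    have "?m < ?L" by (rule mod_less_divisor) (use m(1) in linarith)
    then have mE: "?e ?m \<in> ?E" using vs(3) unfolding C_eq by blast
    obtain c f where cf: "?e ?m = (c, f)" "vs ! ?m \<in> f" by (intro that[OF refl]) simp
    obtain d where d: "(c, d) \<in> C'" "vs ! ?m \<in> d"
      using alternating_cycle_at_vertex[OF C' m(2), of "vs ! ?m" c] by auto
    have "d = f"
      using breakpoint_graph_edge_unique[OF \<pi> subsetD[OF C'E d(1)] mE[unfolded cf(1)] d(2) cf(2)] .
    then show ?thesis using d(1) unfolding cf(1) by simp
  qed
  have "?e ((m0 + t) mod ?L) \<in> C'" for t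
  proof (induction t)
    case 0
    then show ?case using m0 by simp
  next
    case (Suc t)
    have "(m0 + t) mod ?L < ?L" by (rule mod_less_divisor) (use m0(1) in linarith)
    from step[OF this Suc.IH] show ?case by (simp add: mod_Suc_eq)
  qed
  \<comment> \<open>This many steps from \<open>m0\<close> lead round the walk to position
    \<open>m\<close>; adding \<open>?L\<close> before subtracting avoids truncation.\<close>
  then have shift: "?e ((m0 + (m + ?L - m0)) mod ?L) \<in> C'" for m .
  have "?e m \<in> C'" if "m < ?L" for m
  proof -
    have "(m0 + (m + ?L - m0)) mod ?L = m" using that m0(1) by simp
    then show ?thesis using shift[of m] by simp
  qed
  then show ?thesis unfolding C_eq by blast
qed

section \<open>Cycles compared with orbits\<close>

text \<open>The positions of the black edges of distinct cycles form disjoint nonempty sets closed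
  under \<open>next_black\<close>. An upper bound suffices, since the number of cycles enters
  \<open>g_pbi\<close> positively.\<close>

lemma num_cycles_le_orbits:
  assumes \<pi>: "\<pi> permutes {1..n}"
  shows "num_cycles (breakpoint_graph n \<pi>) \<le> card (orbits_on {0..n} (next_black \<pi>))"
proof -
  let ?E = "breakpoint_graph n \<pi>"
  let ?\<C> = "alternating_cycles ?E"
  define blacks where "blacks C = {i. i \<le> n \<and> (Black, black_edge \<pi> i) \<in> C}" for C :: "cedge set"
  have sub: "C \<subseteq> ?E" if "C \<in> ?\<C>" for C using that unfolding alternating_cycles_def by blast
  have ne: "blacks C \<noteq> {}" if C: "C \<in> ?\<C>" for C
  proof -
    from C obtain vs where "C = closed_walk_edges vs" "vs \<noteq> []" unfolding alternating_cycles_def by blast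
    then have "(Black, {vs ! 0, vs ! (Suc 0 mod length vs)}) \<in> C"
      unfolding closed_walk_edges_def by force
    then obtain e where "(Black, e) \<in> C" by blast
    moreover from this obtain i where "i \<le> n" "e = black_edge \<pi> i"
      using subsetD[OF sub[OF C]] unfolding breakpoint_graph_eq[OF \<pi>] by fastforce
    ultimately show ?thesis by (auto simp: blacks_def)
  qed
  have closed: "next_black \<pi> ` blacks C \<subseteq> blacks C" if C: "C \<in> ?\<C>" for C
  proof clarify
    fix i assume i: "i \<in> blacks C"
    then have iC: "i \<le> n" "(Black, black_edge \<pi> i) \<in> C" by (auto simp: blacks_def)
    let ?j = "next_black \<pi> i"
    have j: "?j \<le> n" using permutes_in_image[OF next_black_permutes[OF \<pi>], of i] iC by simp
    have "\<pi> i \<le> n" using permutes_in_image[OF permutes_1_imp_permutes_0[OF \<pi>], of i] iC by simp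
    \<comment> \<open>From the left end of black edge \<open>i\<close>, the grey edge leads to
      \<open>2 * \<pi> i + 1\<close>, the right end of black edge \<open>?j\<close>; the cycle must
      contain both edges.\<close>
    obtain d where d: "(Grey, d) \<in> C" "2 * \<pi> i \<in> d"
      using alternating_cycle_at_vertex[OF C iC(2), of "2 * \<pi> i" Grey] by (auto simp: black_edge_def)
    have "(Grey, {2 * \<pi> i, 2 * \<pi> i + 1}) \<in> ?E"
      unfolding breakpoint_graph_eq[OF \<pi>] using \<open>\<pi> i \<le> n\<close> by blast
    then have "d = {2 * \<pi> i, 2 * \<pi> i + 1}"
      using d sub[OF C] by (intro breakpoint_graph_edge_unique[OF \<pi>, of Grey d _ "2 * \<pi> i"]) auto
    then obtain b where b: "(Black, b) \<in> C" "2 * \<pi> i + 1 \<in> b"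
      using alternating_cycle_at_vertex[OF C d(1), of "2 * \<pi> i + 1" Black] by auto
    have "2 * \<pi> i + 1 \<in> black_edge \<pi> ?j"
      by (simp add: black_edge_def apply_Suc_next_black[OF \<pi>])
    moreover have "(Black, black_edge \<pi> ?j) \<in> ?E"
      unfolding breakpoint_graph_eq[OF \<pi>] using j by blast
    ultimately have "b = black_edge \<pi> ?j"
      using b sub[OF C] breakpoint_graph_edge_unique[OF \<pi>, of Black b _ "2 * \<pi> i + 1"] by blast
    with b j show "?j \<in> blacks C" by (simp add: blacks_def)
  qed
  have eq: "C = C'" if "C \<in> ?\<C>" "C' \<in> ?\<C>" "i \<in> blacks C" "i \<in> blacks C'" for C C' i
    using that alternating_cycle_subset[OF \<pi>] unfolding blacks_def
    by (metis (mono_tags, lifting) mem_Collect_eq subset_antisym)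
  have "inj_on blacks ?\<C>"
    using eq ne by (intro inj_onI) blast
  then have "num_cycles ?E = card (blacks ` ?\<C>)"
    by (simp add: num_cycles_def card_image)
  also have "\<dots> \<le> card (orbits_on {0..n} (next_black \<pi>))"
  proof (rule card_disjoint_closed_le)
    show "pairwise disjnt (blacks ` ?\<C>)"
      using eq unfolding pairwise_def disjnt_iff by blast
    show "A \<subseteq> {0..n} \<and> A \<noteq> {} \<and> next_black \<pi> ` A \<subseteq> A" if "A \<in> blacks ` ?\<C>" for A
      using that ne closed by (fastforce simp: blacks_def)
  qed (use next_black_permutes[OF \<pi>] in auto)
  finally show ?thesis .
qed

lemma closed_walk_edges_pair:
  "closed_walk_edges [a, b] = {(Black, {a, b}), (Grey, {a, b})}"
proof -
  have "{m. m < length [a, b]} = {0, 1}" by auto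
  then show ?thesis
    unfolding closed_walk_edges_def setcompr_eq_image by (simp add: insert_commute)
qed

text \<open>At a fixed point \<open>i\<close>, \<open>\<pi> (Suc i) = Suc (\<pi> i)\<close>, so the
  black edge joins the same vertices as a grey one. A lower bound suffices, since 1-cycles enter
  \<open>g_pbi\<close> negatively.\<close>

lemma fixpoints_le_num_1_cycles:
  assumes \<pi>: "\<pi> permutes {1..n}"
  shows "card (fixpoints_on {0..n} (next_black \<pi>)) \<le> num_k_cycles 1 (breakpoint_graph n \<pi>)"
  unfolding num_k_cycles_def
proof (rule card_inj_on_le)
  let ?E = "breakpoint_graph n \<pi>"
  let ?C = "\<lambda>i. closed_walk_edges [2 * \<pi> i, 2 * \<pi> i + 1]"
  note C = closed_walk_edges_pair
  show "inj_on ?C (fixpoints_on {0..n} (next_black \<pi>))"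
  proof (rule inj_onI)
    fix i j assume "?C i = ?C j"
    then have "\<pi> i = \<pi> j" unfolding C by (auto simp: doubleton_eq_iff)
    then show "i = j" by (simp add: inj_eq[OF permutes_inj[OF \<pi>]])
  qed
  show "finite {C \<in> alternating_cycles ?E. cycle_length C = 1}"
    by (rule finite_subset[of _ "Pow ?E"]) (auto simp: alternating_cycles_def)
  show "?C ` fixpoints_on {0..n} (next_black \<pi>) \<subseteq> {C \<in> alternating_cycles ?E. cycle_length C = 1}"
  proof clarify
    fix i assume "i \<in> fixpoints_on {0..n} (next_black \<pi>)"
    then have i: "i \<le> n" "\<pi> (Suc i) = Suc (\<pi> i)"
      using apply_Suc_next_black[OF \<pi>, of i] by (auto simp: fixpoints_on_def)
    then have "\<pi> i \<le> n" using permutes_in_image[OF permutes_1_imp_permutes_0[OF \<pi>], of i] by simp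
    moreover have "black_edge \<pi> i = {2 * \<pi> i, 2 * \<pi> i + 1}" using i by (simp add: black_edge_def)
    ultimately have "?C i \<subseteq> ?E"
      unfolding C breakpoint_graph_eq[OF \<pi>] using i(1) by blast
    then have "?C i \<in> alternating_cycles ?E"
      unfolding alternating_cycles_def
      by (intro CollectI exI[of _ "[2 * \<pi> i, 2 * \<pi> i + 1]"]) auto
    moreover have "{e \<in> ?C i. fst e = Black} = {(Black, {2 * \<pi> i, 2 * \<pi> i + 1})}"
      unfolding C by auto
    ultimately show "?C i \<in> alternating_cycles ?E \<and> cycle_length (?C i) = 1"
      by (simp add: cycle_length_def)
  qed
qed

text \<open>Fixed points correspond to 1-cycles, except that the cost leaves out 0. The term
  \<open>f_pbi\<close> makes up for this, as 0 is fixed exactly when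
  \<open>\<pi> 1 = 1\<close>.\<close>

lemma g_pbi_le_star_cost:
  assumes \<pi>: "\<pi> permutes {1..n}"
  shows "2 * g_pbi n \<pi> \<le> real_of_int (star_cost {0..n} 0 (next_black \<pi>))"
proof -
  let ?f = "next_black \<pi>"
  have "\<pi> 1 = 1 \<longleftrightarrow> ?f 0 = 0"
  proof
    show "?f 0 = 0" if "\<pi> 1 = 1"
      using that permutes_1_0[OF \<pi>] by (intro next_black_eqI[OF \<pi>]) simp
    show "\<pi> 1 = 1" if "?f 0 = 0"
      using apply_Suc_next_black[OF \<pi>, of 0] that permutes_1_0[OF \<pi>] by simp
  qed
  then have "fixpoints_on {0..n} ?f =
      (if \<pi> 1 = 1 then insert 0 (fixpoints_on ({0..n} - {0}) ?f) else fixpoints_on ({0..n} - {0}) ?f)"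
    unfolding fixpoints_on_def by (cases "\<pi> 1 = 1") (force, auto intro!: gr0I)
  moreover have "0 \<notin> fixpoints_on ({0..n} - {0}) ?f" "finite (fixpoints_on ({0..n} - {0}) ?f)"
    by (simp_all add: fixpoints_on_def)
  ultimately have "card (fixpoints_on {0..n} ?f) + f_pbi \<pi> = card (fixpoints_on ({0..n} - {0}) ?f) + 1"
    by (simp add: f_pbi_def split: if_splits)
  then show ?thesis
    using num_cycles_le_orbits[OF \<pi>] fixpoints_le_num_1_cycles[OF \<pi>]
    by (simp add: g_pbi_def star_cost_def field_simps)
qed

theorem theorem3p10:
  fixes n :: nat and \<pi> :: "nat \<Rightarrow> nat"
  assumes "n \<ge> 1"
    and "\<pi> permutes {1..n}"
  shows "real (pbid n \<pi>) \<ge> g_pbi n \<pi> / 2"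
proof -
  \<comment> \<open>The least length is attained because some sorting sequence exists.\<close>
  have "\<exists>\<beta>s. length \<beta>s = pbid n \<pi> \<and> sorts_by_pbi n \<pi> \<beta>s"
    unfolding pbid_def
    by (rule LeastI_ex[where P = "\<lambda>t. \<exists>\<beta>s. length \<beta>s = t \<and> sorts_by_pbi n \<pi> \<beta>s"])
      (use ex_sorts_by_pbi[OF assms(2)] in blast)
  then obtain \<beta>s where "length \<beta>s = pbid n \<pi>" "sorts_by_pbi n \<pi> \<beta>s" by blast
  then have "star_cost {0..n} 0 (next_black \<pi>) \<le> 4 * int (pbid n \<pi>)"
    using star_cost_le_length assms(2) by metis
  then have "real_of_int (star_cost {0..n} 0 (next_black \<pi>)) \<le> 4 * real (pbid n \<pi>)"
    by linarith
  \<comment> \<open>The cost lies between \<open>2 * g_pbi n \<pi>\<close> and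
    \<open>4 * pbid n \<pi>\<close>.\<close>
  with g_pbi_le_star_cost[OF assms(2)] show ?thesis by linarith
qed

end
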